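(* There is a transitive homeomorphism on the Lelek fan; that is, there exist a continuum $X$ which is a Lelek fan and a homeomorphism $\varphi:X\to X$ such that the dynamical system $(X,\varphi)$ is transitive.
   Context: A continuum is a non-empty compact connected metric space. A continuum is unicoherent if whenever it is the union of two subcontinua $A,B$, the set $A\cap B$ is connected; it is hereditarily unicoherent if each of its subcontinua is unicoherent. A dendroid is an arcwise connected, hereditarily unicoherent continuum. An end-point of a dendroid $X$ is a point $x\in X$ which is an end-point of every arc in $X$ that contains it; $E(X)$ is the set of end-points of $X$. A simple triod is a space homeomorphic to $([-1,1]\times\{0\})\cup(\{0\}\times[0,1])$, and its top is the point corresponding to $(0,0)$. A ramification point of a dendroid $X$ is a point that is the top of some simple triod in $X$. A fan is a dendroid with at most one ramification point $v$, called the top of the fan (if it exists). In a fan, $A[x,y]$ denotes the arc with end-points $x$ and $y$ if $x\neq y$, and $A[x,x]=\{x\}$. A fan $X$ with top $v$ is smooth if for every $x\in X$ and every sequence $(x_n)$ in $X$ with $x_n\to x$, we have $A[v,x_n]\to A[v,x]$ with respect to the Hausdorff metric (smoothness refers to fans having a top). A Lelek fan is a smooth fan $X$ with $\mathrm{Cl}(E(X))=X$. A dynamical system $(X,f)$ (with $f:X\to X$ continuous) is transitive if for all non-empty open sets $U,V\subseteq X$ there is a non-negative integer $n$ with $f^n(U)\cap V\neq\emptyset$; the map $f$ is then called transitive. *)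

theory Defs
  imports "HOL-Analysis.Analysis"
begin

definition continuum :: "'a::metric_space set \<Rightarrow> bool" where
  "continuum X \<longleftrightarrow> X \<noteq> {} \<and> compact X \<and> connected X"

text \<open>The library predicate \<^const>\<open>unicoherent\<close> quantifies over closed connected pieces; on a
  continuum this is the usual condition on decompositions into two subcontinua.\<close>

lemma continuum_unicoherent_iff:
  assumes "continuum X"
  shows "unicoherent X \<longleftrightarrow>
    (\<forall>A B. continuum A \<and> continuum B \<and> A \<union> B = X \<longrightarrow> connected (A \<inter> B))"
proof
  assume u: "unicoherent X"
  show "\<forall>A B. continuum A \<and> continuum B \<and> A \<union> B = X \<longrightarrow> connected (A \<inter> B)"
  proof (intro allI impI, elim conjE)
    fix A B assume "continuum A" "continuum B" "A \<union> B = X"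
    then show "connected (A \<inter> B)"
      by (intro unicoherentD[OF u])
         (auto simp: continuum_def intro!: closed_subset compact_imp_closed)
  qed
next
  assume c: "\<forall>A B. continuum A \<and> continuum B \<and> A \<union> B = X \<longrightarrow> connected (A \<inter> B)"
  show "unicoherent X"
  proof
    fix S T
    assume *: "connected S" "connected T" "X = S \<union> T"
      "closedin (top_of_set X) S" "closedin (top_of_set X) T"
    then have "compact S" "compact T"
      using assms closedin_compact continuum_def by blast+
    then show "connected (S \<inter> T)"
      using * c by (cases "S = {} \<or> T = {}") (auto simp: continuum_def)
  qed
qed

definition hereditarily_unicoherent :: "'a::metric_space set \<Rightarrow> bool" where
  "hereditarily_unicoherent X \<longleftrightarrow> (\<forall>Y. Y \<subseteq> X \<and> continuum Y \<longrightarrow> unicoherent Y)"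

definition arc_joining :: "'a::metric_space \<Rightarrow> 'a \<Rightarrow> 'a set \<Rightarrow> bool" where
  "arc_joining x y A \<longleftrightarrow>
    (\<exists>g. arc g \<and> path_image g = A \<and> pathstart g = x \<and> pathfinish g = y)"

definition arcwise_connected :: "'a::metric_space set \<Rightarrow> bool" where
  "arcwise_connected X \<longleftrightarrow>
    (\<forall>x\<in>X. \<forall>y\<in>X. x \<noteq> y \<longrightarrow> (\<exists>A. A \<subseteq> X \<and> arc_joining x y A))"

definition dendroid :: "'a::metric_space set \<Rightarrow> bool" where
  "dendroid X \<longleftrightarrow> continuum X \<and> arcwise_connected X \<and> hereditarily_unicoherent X"

definition end_points :: "'a::metric_space set \<Rightarrow> 'a set" where
  "end_points X =
    {x \<in> X. \<forall>A a b. A \<subseteq> X \<and> arc_joining a b A \<and> x \<in> A \<longrightarrow> x = a \<or> x = b}"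

definition standard_triod :: "(real \<times> real) set" where
  "standard_triod = ({-1..1} \<times> {0}) \<union> ({0} \<times> {0..1})"

definition ramification_points :: "'a::metric_space set \<Rightarrow> 'a set" where
  "ramification_points X =
    {v. \<exists>T h k. T \<subseteq> X \<and> homeomorphism standard_triod T h k \<and> h (0, 0) = v}"

definition fan :: "'a::metric_space set \<Rightarrow> bool" where
  "fan X \<longleftrightarrow> dendroid X \<and>
    (\<forall>u \<in> ramification_points X. \<forall>v \<in> ramification_points X. u = v)"

definition fan_with_top :: "'a::metric_space set \<Rightarrow> 'a \<Rightarrow> bool" where
  "fan_with_top X v \<longleftrightarrow> fan X \<and> v \<in> ramification_points X"

text \<open>The arc \<open>A[x, y]\<close>; in a dendroid the arc joining two distinct points is unique.\<close>

definition arc_in :: "'a::metric_space set \<Rightarrow> 'a \<Rightarrow> 'a \<Rightarrow> 'a set" where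
  "arc_in X x y = (if x = y then {x} else (THE A. A \<subseteq> X \<and> arc_joining x y A))"

text \<open>Intended for non-empty bounded sets.\<close>

definition hausdorff_distance :: "'a::metric_space set \<Rightarrow> 'a set \<Rightarrow> real" where
  "hausdorff_distance A B = max (SUP a\<in>A. infdist a B) (SUP b\<in>B. infdist b A)"

definition smooth_fan :: "'a::metric_space set \<Rightarrow> 'a \<Rightarrow> bool" where
  "smooth_fan X v \<longleftrightarrow> fan_with_top X v \<and>
    (\<forall>x\<in>X. \<forall>s :: nat \<Rightarrow> 'a. (\<forall>n. s n \<in> X) \<and> s \<longlonglongrightarrow> x \<longrightarrow>
      (\<lambda>n. hausdorff_distance (arc_in X v (s n)) (arc_in X v x)) \<longlonglongrightarrow> 0)"

definition Lelek_fan :: "'a::metric_space set \<Rightarrow> bool" where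
  "Lelek_fan X \<longleftrightarrow> (\<exists>v. smooth_fan X v) \<and> closure (end_points X) = X"

definition dynamical_system :: "'a::metric_space set \<Rightarrow> ('a \<Rightarrow> 'a) \<Rightarrow> bool" where
  "dynamical_system X f \<longleftrightarrow> continuous_on X f \<and> f ` X \<subseteq> X"

definition transitive_system :: "'a::metric_space set \<Rightarrow> ('a \<Rightarrow> 'a) \<Rightarrow> bool" where
  "transitive_system X f \<longleftrightarrow> dynamical_system X f \<and>
    (\<forall>U V. openin (top_of_set X) U \<and> openin (top_of_set X) V \<and> U \<noteq> {} \<and> V \<noteq> {} \<longrightarrow>
      (\<exists>n::nat. (f ^^ n) ` U \<inter> V \<noteq> {}))"

text \<open>Types cannot be quantified existentially, so an existence statement about metric continua
  is made for subsets of \<^typ>\<open>nat \<Rightarrow> real\<close>. The library metric there induces the product topology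
  of countably many lines, in which every compact metric space embeds; and all notions above are
  invariant under homeomorphisms between compact spaces, so this loses no generality.\<close>

end

theory Submission
  imports Defs "HOL-Library.Nat_Bijection"
begin

text \<open>The fan consists of the two-sided sequences in \<open>[0, 1]\<close> whose successive ratios are all \<open>1/2\<close> or
  \<open>3\<close>, and the homeomorphism is the shift. Nonzero points with the same ratios form a half-open
  interval ending at the zero sequence, and points whose ratios differ can be separated away from
  it; hence the space is a smooth fan with the zero sequence as top. A point with some coordinate
  equal to \<open>1\<close> is an end-point. Since \<open>2\<close> and \<open>3\<close> are multiplicatively independent, the products
  \<open>(1/2)^k 3^l\<close> are dense in the positive reals. By first halving and then tripling, the past of one point
  can therefore be joined to the future of a slight contraction of another one, which gives
  transitivity, and the same device with a future starting at \<open>1\<close> gives density of the end-points.\<close>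

section \<open>Two-sided sequences and the compact space of admissible ones\<close>

text \<open>Two-sided sequences are coded as elements of \<^typ>\<open>nat \<Rightarrow> real\<close>; \<open>co x i\<close> is the
  \<open>i\<close>-th coordinate.\<close>

definition co :: "(nat \<Rightarrow> real) \<Rightarrow> int \<Rightarrow> real" where
  "co x i = x (int_encode i)"

definition of_co :: "(int \<Rightarrow> real) \<Rightarrow> nat \<Rightarrow> real" where
  "of_co y n = y (int_decode n)"

definition origin :: "nat \<Rightarrow> real" where
  "origin = (\<lambda>_. 0)"

definition dilate :: "real \<Rightarrow> (nat \<Rightarrow> real) \<Rightarrow> nat \<Rightarrow> real" where
  "dilate t x = (\<lambda>n. t * x n)"

text \<open>The two-sided Mahavier product of the closed relation on [0, 1] whose graph consists of
  two segments through the origin, of slopes 1/2 and 3.\<close>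

definition Mahavier :: "(nat \<Rightarrow> real) set" where
  "Mahavier = {x. (\<forall>i. 0 \<le> co x i \<and> co x i \<le> 1) \<and>
    (\<forall>i. co x (i + 1) = co x i / 2 \<or> co x (i + 1) = 3 * co x i)}"

definition spoke :: "(nat \<Rightarrow> real) \<Rightarrow> (nat \<Rightarrow> real) set" where
  "spoke x = (\<lambda>t. dilate t x) ` {0..1}"

lemma co_of_co [simp]: "co (of_co y) i = y i"
  by (simp add: co_def of_co_def)

lemma of_co_co [simp]: "of_co (co x) = x"
  by (simp add: co_def of_co_def fun_eq_iff)

lemma co_eqI: "(\<And>i. co x i = co y i) \<Longrightarrow> x = y"
  by (metis of_co_co ext)

lemma co_dilate [simp]: "co (dilate t x) i = t * co x i"
  by (simp add: co_def dilate_def)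

lemma co_origin [simp]: "co origin i = 0"
  by (simp add: co_def origin_def)

lemma dilate_0 [simp]: "dilate 0 x = origin"
  by (simp add: dilate_def origin_def)

lemma dilate_1 [simp]: "dilate 1 x = x"
  by (simp add: dilate_def)

lemma dilate_origin [simp]: "dilate t origin = origin"
  by (simp add: dilate_def origin_def)

lemma dilate_dilate [simp]: "dilate s (dilate t x) = dilate (s * t) x"
  by (simp add: dilate_def mult.assoc)

lemma continuous_on_co [continuous_intros]:
  "continuous_on S f \<Longrightarrow> continuous_on S (\<lambda>z. co (f z) i)"
  unfolding co_def by (rule continuous_on_product_then_coordinatewise)

lemma continuous_on_into_co:
  assumes "\<And>i. continuous_on S (\<lambda>z. co (f z) i)"
  shows "continuous_on S f"
proof (rule continuous_on_coordinatewise_then_product)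
  fix n
  show "continuous_on S (\<lambda>z. f z n)"
    using assms[of "int_decode n"] by (simp add: co_def)
qed

lemma continuous_on_dilate [continuous_intros]:
  assumes "continuous_on S f" "continuous_on S g"
  shows "continuous_on S (\<lambda>z. dilate (f z) (g z))"
  by (rule continuous_on_into_co) (simp, intro continuous_intros assms)

lemma MahavierI:
  assumes "\<And>i. 0 \<le> co x i" "\<And>i. co x i \<le> 1"
    "\<And>i. co x (i + 1) = co x i / 2 \<or> co x (i + 1) = 3 * co x i"
  shows "x \<in> Mahavier"
  using assms by (auto simp: Mahavier_def)

lemma Mahavier_nonneg: "x \<in> Mahavier \<Longrightarrow> 0 \<le> co x i"
  and Mahavier_le_1: "x \<in> Mahavier \<Longrightarrow> co x i \<le> 1"
  and Mahavier_step: "x \<in> Mahavier \<Longrightarrow> co x (i + 1) = co x i / 2 \<or> co x (i + 1) = 3 * co x i"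
  by (auto simp: Mahavier_def)

lemma origin_in_Mahavier [simp]: "origin \<in> Mahavier"
  by (rule MahavierI) auto

lemma dilate_in_Mahavier:
  assumes "x \<in> Mahavier" "0 \<le> t" "\<And>i. t * co x i \<le> 1"
  shows "dilate t x \<in> Mahavier"
proof (rule MahavierI)
  fix i
  show "co (dilate t x) (i + 1) = co (dilate t x) i / 2 \<or> co (dilate t x) (i + 1) = 3 * co (dilate t x) i"
    using Mahavier_step[OF assms(1), of i] by auto
qed (use assms Mahavier_nonneg in auto)

lemma dilate_in_Mahavier':
  assumes "x \<in> Mahavier" "0 \<le> t" "t \<le> 1"
  shows "dilate t x \<in> Mahavier"
  using assms by (intro dilate_in_Mahavier) (auto intro: mult_le_one Mahavier_nonneg Mahavier_le_1)

text \<open>Every step multiplies by a positive factor, so positivity spreads in both directions.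
  Hence a nonzero point has no zero coordinate and all its ratios are defined.\<close>

lemma co_pos_if_co_pos:
  assumes "x \<in> Mahavier" "co x i > 0"
  shows "co x j > 0"
proof (induction j rule: int_induct[where k = i])
  case (step1 j)
  then show ?case using Mahavier_step[OF assms(1), of j] by auto
next
  case (step2 j)
  then show ?case using Mahavier_step[OF assms(1), of "j - 1"] by auto
qed (rule assms)

lemma co_pos:
  assumes "x \<in> Mahavier" "x \<noteq> origin"
  shows "co x i > 0"
proof (rule ccontr)
  assume "\<not> co x i > 0"
  then have "co x j = 0" for j
    using co_pos_if_co_pos[OF assms(1), of j i] Mahavier_nonneg[OF assms(1), of j] by linarith
  then have "x = origin" by (intro co_eqI) simp
  with assms show False by simp
qed

text \<open>The cube is compact by Tychonoff, and each step condition is a disjunction of two closed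
  conditions.\<close>

lemma compact_Mahavier: "compact Mahavier"
proof -
  have "compact (Pi\<^sub>E UNIV (\<lambda>_::nat. {0..1::real}))"
    using compactin_PiE[of "\<lambda>_. euclidean" UNIV "\<lambda>_::nat. {0..1::real}"]
    by (simp add: euclidean_product_topology)
  moreover have "closed Mahavier"
    unfolding Mahavier_def
    by (intro closed_Collect_conj closed_Collect_all closed_Collect_disj closed_Collect_le
        closed_Collect_eq continuous_intros continuous_on_id) auto
  moreover have "Mahavier \<subseteq> Pi\<^sub>E UNIV (\<lambda>_::nat. {0..1::real})"
  proof (clarsimp simp: PiE_def)
    fix x n assume "x \<in> Mahavier"
    then show "0 \<le> x n \<and> x n \<le> 1"
      using Mahavier_nonneg[of x "int_decode n"] Mahavier_le_1[of x "int_decode n"]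
      by (simp add: co_def)
  qed
  ultimately show ?thesis
    by (metis compact_Int_closed inf.absorb_iff2)
qed

section \<open>Neighbourhoods, proportionality and connected subsets\<close>

lemma window_neighbourhood:
  assumes "open U" "x \<in> U"
  obtains N \<epsilon> where "N \<ge> (0::int)" "\<epsilon> > (0::real)"
    "\<And>y. (\<And>i. \<bar>i\<bar> \<le> N \<Longrightarrow> \<bar>co y i - co x i\<bar> < \<epsilon>) \<Longrightarrow> y \<in> U"
proof -
  obtain e where e: "e > 0" "\<And>y. dist y x < e \<Longrightarrow> y \<in> U"
    using assms open_dist by blast
  obtain K where K: "(1/2) ^ K < e / 2"
    using real_arch_pow_inv[of "e / 2" "1/2"] e by auto
  define N where "N = Max ((\<lambda>n. \<bar>int_decode (from_nat n)\<bar>) ` {..K})"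
  have N: "\<bar>int_decode (from_nat n)\<bar> \<le> N" if "n \<le> K" for n
    unfolding N_def using that by (intro Max_ge) auto
  show ?thesis
  proof
    show "N \<ge> 0" using N[of 0] by linarith
    \<comment> \<open>The distance is at most twice the largest difference in the terms up to
      \<open>K\<close>, plus \<open>(1/2) ^ K\<close>. Differences below \<open>e / 4\<close> and a
      tail below \<open>e / 2\<close> bring it under \<open>e\<close>.\<close>
    show "e / 4 > 0" using e by simp
    fix y assume y: "\<And>i. \<bar>i\<bar> \<le> N \<Longrightarrow> \<bar>co y i - co x i\<bar> < e / 4"
    let ?D = "{dist (y (from_nat n)) (x (from_nat n)) |n. n \<le> K}"
    have D: "?D = (\<lambda>n. dist (y (from_nat n)) (x (from_nat n))) ` {..K}" by auto
    have "Max ?D < e / 4"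
      unfolding D
      using y[OF N] by (subst Max_less_iff) (auto simp: co_def dist_real_def)
    then have "dist y x < e"
      using dist_fun_le_dist_first_terms[of y x K] K by linarith
    then show "y \<in> U" by (rule e)
  qed
qed

text \<open>Termwise comparison of the series defining the metric. Dilations being nonexpanding is
  what later bounds the Hausdorff distance of spokes.\<close>

lemma dist_dilate_le:
  assumes "0 \<le> t" "t \<le> 1"
  shows "dist (dilate t x) (dilate t y) \<le> dist x y"
proof -
  have summ: "summable (\<lambda>n. (1/2)^n * min (dist (x (from_nat n)) (y (from_nat n))) 1)" for x y :: "nat \<Rightarrow> real"
    by (rule summable_comparison_test'[of "\<lambda>n. (1/2)^n"]) (auto simp: summable_geometric_iff)
  have "dist (dilate t x n) (dilate t y n) \<le> dist (x n) (y n)" for n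
  proof -
    have "\<bar>t * (x n - y n)\<bar> \<le> \<bar>x n - y n\<bar>"
      using assms by (simp add: abs_mult mult_left_le_one_le)
    then show ?thesis by (simp add: dilate_def dist_real_def right_diff_distrib)
  qed
  then show ?thesis
    unfolding dist_fun_def by (intro suminf_le summ mult_left_mono min.mono) auto
qed

text \<open>At a nonzero point the sign of \<open>co z (i + 1) - 2 * co z i\<close> tells whether
  the ratio at \<open>i\<close> is 3 or 1/2. A positive product thus means equal ratios, and
  proportionality propagates outwards from index 0. Without division the condition is given by a
  continuous function on the whole space, including the origin.\<close>

lemma proportional_on_window:
  assumes x: "x \<in> Mahavier" "x \<noteq> origin" and y: "y \<in> Mahavier" "y \<noteq> origin"
    and same: "\<And>i. \<bar>i\<bar> \<le> N \<Longrightarrow> (co x (i + 1) - 2 * co x i) * (co y (i + 1) - 2 * co y i) > 0"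
    and "\<bar>i\<bar> \<le> N"
  shows "co y i * co x 0 = co x i * co y 0"
proof -
  have ratio: "\<exists>c > 0. co x (j + 1) = c * co x j \<and> co y (j + 1) = c * co y j" if "\<bar>j\<bar> \<le> N" for j
  proof -
    have "co x (j + 1) = 1/2 * co x j \<and> co y (j + 1) = 1/2 * co y j \<or>
      co x (j + 1) = 3 * co x j \<and> co y (j + 1) = 3 * co y j"
      using same[OF that] Mahavier_step[OF x(1), of j] Mahavier_step[OF y(1), of j]
        co_pos[OF x, of j] co_pos[OF y, of j]
      by (auto simp: zero_less_mult_iff)
    then show ?thesis
      by (metis half_gt_zero_iff zero_less_numeral zero_less_one)
  qed
  have "\<bar>i\<bar> \<le> N \<longrightarrow> co y i * co x 0 = co x i * co y 0"
  proof (induction i rule: int_induct[where k = 0])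
    case (step1 j)
    show ?case
    proof
      assume "\<bar>j + 1\<bar> \<le> N"
      with step1 have j: "\<bar>j\<bar> \<le> N" "co y j * co x 0 = co x j * co y 0" by auto
      with ratio[of j] show "co y (j + 1) * co x 0 = co x (j + 1) * co y 0" by auto
    qed
  next
    case (step2 j)
    show ?case
    proof
      assume "\<bar>j - 1\<bar> \<le> N"
      with step2 have j: "\<bar>j - 1\<bar> \<le> N" "co y j * co x 0 = co x j * co y 0" by auto
      with ratio[of "j - 1"] show "co y (j - 1) * co x 0 = co x (j - 1) * co y 0" by auto
    qed
  qed auto
  with assms show ?thesis by blast
qed

lemma proportional_imp_dilate:
  assumes x: "x \<in> Mahavier" "x \<noteq> origin" and "\<And>i. co y i * co x 0 = co x i * co y 0"
  shows "y = dilate (co y 0 / co x 0) x"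
  using assms(3) co_pos[OF x, of 0] by (intro co_eqI) (simp add: field_simps)

text \<open>The ratios \<open>co z (i + 1) / co z i\<close> are continuous and take only two values away from the
  origin, so they are constant on connected sets.\<close>

lemma connected_avoiding_origin:
  assumes C: "connected C" "C \<subseteq> Mahavier" "origin \<notin> C" and xy: "x \<in> C" "y \<in> C"
  shows "y = dilate (co y 0 / co x 0) x"
proof -
  have pos: "co z i > 0" if "z \<in> C" for z i
    using co_pos[of z i] that C by blast
  have "(co x (i + 1) - 2 * co x i) * (co y (i + 1) - 2 * co y i) > 0" for i
  proof -
    let ?f = "\<lambda>z. co z (i + 1) / co z i"
    have f: "?f z = 1/2 \<or> ?f z = 3" if "z \<in> C" for z
      using Mahavier_step[of z i] pos[OF that, of i] that C by (auto simp: field_simps)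
    have "?f constant_on C"
    proof (rule continuous_finite_range_constant[OF C(1)])
      show "continuous_on C ?f"
        by (intro continuous_intros continuous_on_id) (metis pos less_irrefl)
      have "?f ` C \<subseteq> {1/2, 3}" using f by blast
      then show "finite (?f ` C)" using finite_subset by blast
    qed
    then have "?f x = ?f y" using xy by (auto simp: constant_on_def)
    with f[OF xy(1)] pos[OF xy(1), of i] pos[OF xy(2), of i] show ?thesis
      by (auto simp: field_simps)
  qed
  moreover have "x \<in> Mahavier" "y \<in> Mahavier" "x \<noteq> origin" "y \<noteq> origin"
    using C xy by auto
  ultimately have "co y i * co x 0 = co x i * co y 0" for i
    using proportional_on_window[of x y "\<bar>i\<bar>" i] by simp
  with \<open>x \<in> Mahavier\<close> \<open>x \<noteq> origin\<close> show ?thesis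
    by (intro proportional_imp_dilate) auto
qed

text \<open>If \<open>dilate s x\<close> were missing from \<open>C\<close>, then the points of \<open>C\<close> that lie above height \<open>s * co x 0\<close>
  and have the same ratios as \<open>x\<close> on a large window would form a clopen subset of \<open>C\<close>.\<close>

lemma connected_spoke_convex:
  assumes C: "connected C" "closed C" "C \<subseteq> Mahavier"
    and x: "x \<in> C" "dilate t x \<in> C" and s: "0 \<le> t" "t \<le> s" "s \<le> 1"
  shows "dilate s x \<in> C"
proof (rule ccontr)
  assume ns: "dilate s x \<notin> C"
  then have "x \<noteq> origin" using x by auto
  have "t \<noteq> s" "s \<noteq> 1" using ns x by auto
  with s have ts: "t < s" "s < 1" by auto
  have xM: "x \<in> Mahavier" using x C by auto
  have x0: "co x i > 0" for i using co_pos[OF xM \<open>x \<noteq> origin\<close>] .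
  obtain N \<epsilon> where N: "N \<ge> 0" and "\<epsilon> > 0" and nbd:
    "\<And>y. (\<And>i. \<bar>i\<bar> \<le> N \<Longrightarrow> \<bar>co y i - co (dilate s x) i\<bar> < \<epsilon>) \<Longrightarrow> y \<in> - C"
    using window_neighbourhood[of "- C" "dilate s x"] ns C(2) by (metis ComplI open_Compl)
  define d where "d z i = (co x (i + 1) - 2 * co x i) * (co z (i + 1) - 2 * co z i)" for z i
  define W where "W = {z. co z 0 > s * co x 0 \<and> (\<forall>i\<in>{-N..N}. d z i > 0)}"
  define W' where "W' = {z. co z 0 \<ge> s * co x 0 \<and> (\<forall>i\<in>{-N..N}. d z i \<ge> 0)}"
  have "open W"
  proof -
    have "W = {z. co z 0 > s * co x 0} \<inter> (\<Inter>i\<in>{-N..N}. {z. d z i > 0})"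
      by (auto simp: W_def)
    also have "open \<dots>"
      unfolding d_def
      by (intro open_Int open_INT ballI open_Collect_less continuous_intros continuous_on_id) auto
    finally show ?thesis .
  qed
  have "closed W'"
  proof -
    have "W' = {z. co z 0 \<ge> s * co x 0} \<inter> (\<Inter>i\<in>{-N..N}. {z. d z i \<ge> 0})"
      by (auto simp: W'_def)
    also have "closed \<dots>"
      unfolding d_def
      by (intro closed_Int closed_INT ballI closed_Collect_le continuous_intros continuous_on_id)
    finally show ?thesis .
  qed
  \<comment> \<open>In \<open>C\<close> the weak inequalities imply the strict ones. Nonzero points
    never have \<open>d z i = 0\<close>, and equality of heights would, by proportionality, make
    \<open>z\<close> agree with \<open>dilate s x\<close> on the window, whose neighbourhood misses
    \<open>C\<close>.\<close>
  have "C \<inter> W = C \<inter> W'"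
  proof (intro equalityI subsetI IntI)
    fix z assume "z \<in> C \<inter> W'"
    then have z: "z \<in> C" "z \<in> Mahavier" "co z 0 \<ge> s * co x 0"
      and dz: "\<And>i. \<bar>i\<bar> \<le> N \<Longrightarrow> d z i \<ge> 0"
      using C by (auto simp: W'_def abs_le_iff)
    have "co z 0 > 0"
      using z(3) x0[of 0] s ts by (smt (verit) mult_pos_pos)
    then have zo: "z \<noteq> origin" by auto
    have z0: "co z i > 0" for i using co_pos[OF z(2) zo] .
    have dz': "d z i > 0" if "\<bar>i\<bar> \<le> N" for i
      using dz[OF that] Mahavier_step[OF xM, of i] Mahavier_step[OF z(2), of i] x0[of i] z0[of i]
      unfolding d_def zero_le_mult_iff zero_less_mult_iff by auto
    have "co z 0 \<noteq> s * co x 0"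
    proof
      assume eq: "co z 0 = s * co x 0"
      have "co z i = s * co x i" if "\<bar>i\<bar> \<le> N" for i
        using proportional_on_window[OF xM \<open>x \<noteq> origin\<close> z(2) zo, of N i] dz' that eq x0[of 0]
        by (auto simp: d_def field_simps)
      then have "z \<in> - C" using \<open>\<epsilon> > 0\<close> by (intro nbd) auto
      with z show False by simp
    qed
    with z dz' show "z \<in> W" by (auto simp: W_def abs_le_iff)
  qed (auto simp: W_def W'_def less_imp_le)
  then have "openin (top_of_set C) (C \<inter> W)" "closedin (top_of_set C) (C \<inter> W)"
    using \<open>open W\<close> \<open>closed W'\<close> by (metis openin_open_Int, metis closedin_closed_Int)
  moreover have "x \<in> C \<inter> W"
  proof -
    have "d x i > 0" for i
      unfolding d_def using Mahavier_step[OF xM, of i] x0[of i] by (auto simp: zero_less_mult_iff)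
    then show ?thesis using x ts x0[of 0] by (auto simp: W_def)
  qed
  moreover have "dilate t x \<notin> W"
    using ts x0[of 0] by (simp add: W_def)
  ultimately show False
    using C(1) x(2) unfolding connected_clopen by blast
qed

text \<open>Any two points of \<open>C\<close> are multiples of each other, and a single positive
  coordinate determines the factor. So such a \<open>C\<close> is mapped injectively into the line,
  which is how both ramification points and end-points are recognised.\<close>

lemma Mahavier_coordinate_inj:
  assumes "connected C" "C \<subseteq> Mahavier" "origin \<notin> C"
  shows "inj_on (\<lambda>x. co x i) C"
proof (rule inj_onI)
  fix x y assume xy: "x \<in> C" "y \<in> C" and eq: "co x i = co y i"
  have y: "y = dilate (co y 0 / co x 0) x"
    using connected_avoiding_origin[OF assms xy] .
  have "co x i > 0" using co_pos[of x i] assms xy by blast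
  moreover have "co y i = co y 0 / co x 0 * co x i"
    by (subst y) simp
  ultimately have "co y 0 / co x 0 = 1"
    unfolding eq by (metis less_irrefl mult_cancel_right1)
  then have "x = dilate (co y 0 / co x 0) x" by simp
  also note y[symmetric]
  finally show "x = y" .
qed

section \<open>Connectedness and hereditary unicoherence\<close>

lemma origin_in_spoke: "origin \<in> spoke x"
  and self_in_spoke: "x \<in> spoke x"
  unfolding spoke_def by (auto intro: image_eqI[of _ _ 0] image_eqI[of _ _ 1])

lemma connected_dilates: "connected ((\<lambda>t. dilate t x) ` {a..b})"
  by (intro connected_continuous_image continuous_intros continuous_on_id connected_Icc)

lemma connected_star_shaped:
  assumes "\<And>x. x \<in> S \<Longrightarrow> spoke x \<subseteq> S"
  shows "connected S"
proof -
  have "S = \<Union> (spoke ` S)" using assms self_in_spoke by auto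
  moreover have "connected (\<Union> (spoke ` S))"
  proof (rule connected_Union)
    have "origin \<in> \<Inter> (spoke ` S)" using origin_in_spoke by blast
    then show "\<Inter> (spoke ` S) \<noteq> {}" by blast
  qed (auto simp: spoke_def connected_dilates)
  ultimately show ?thesis by simp
qed

lemma spoke_subset_Mahavier: "x \<in> Mahavier \<Longrightarrow> spoke x \<subseteq> Mahavier"
  by (auto simp: spoke_def intro: dilate_in_Mahavier')

lemma continuum_Mahavier: "continuum Mahavier"
  unfolding continuum_def
proof (intro conjI)
  show "Mahavier \<noteq> {}" using origin_in_Mahavier by (metis empty_iff)
  show "connected Mahavier" by (rule connected_star_shaped) (rule spoke_subset_Mahavier)
qed (rule compact_Mahavier)

lemma spoke_subset_connected:
  assumes "connected C" "closed C" "C \<subseteq> Mahavier" "x \<in> C" "origin \<in> C"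
  shows "spoke x \<subseteq> C"
  using connected_spoke_convex[OF assms(1-4), of 0] assms(5) by (auto simp: spoke_def)

text \<open>If both sets contain the origin, each is a union of spokes, and so is the intersection.
  Otherwise one of them avoids the origin, so all points of the intersection are multiples of one
  another, and both sets contain the whole segment between two such points.\<close>

lemma connected_Int_Mahavier:
  assumes A: "connected A" "closed A" "A \<subseteq> Mahavier"
    and B: "connected B" "closed B" "B \<subseteq> Mahavier"
  shows "connected (A \<inter> B)"
proof (cases "origin \<in> A \<inter> B")
  case True
  then show ?thesis
    using spoke_subset_connected[OF A] spoke_subset_connected[OF B]
    by (intro connected_star_shaped) auto
next
  case False
  have *: "connected_component (A \<inter> B) p q"
    if "p \<in> A \<inter> B" "q \<in> A \<inter> B" "q = dilate r p" "0 \<le> r" "r \<le> 1" for p q r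
  proof -
    have "dilate s p \<in> A \<inter> B" if "s \<in> {r..1}" for s
      using connected_spoke_convex[OF A, of p r s] connected_spoke_convex[OF B, of p r s] that
        \<open>p \<in> A \<inter> B\<close> \<open>q \<in> A \<inter> B\<close> \<open>q = dilate r p\<close> \<open>0 \<le> r\<close> by auto
    then have "(\<lambda>s. dilate s p) ` {r..1} \<subseteq> A \<inter> B" by blast
    moreover have "p \<in> (\<lambda>s. dilate s p) ` {r..1}" "q \<in> (\<lambda>s. dilate s p) ` {r..1}"
      using that by (auto intro: image_eqI[of _ _ 1])
    ultimately show ?thesis
      unfolding connected_component_def using connected_dilates by blast
  qed
  show ?thesis
    unfolding connected_iff_connected_component
  proof (intro ballI)
    fix x y assume xy: "x \<in> A \<inter> B" "y \<in> A \<inter> B"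
    define r where "r = co y 0 / co x 0"
    have y: "y = dilate r x"
      using False connected_avoiding_origin[OF A(1,3), of x y]
        connected_avoiding_origin[OF B(1,3), of x y] xy by (auto simp: r_def)
    have "r \<ge> 0"
      unfolding r_def using xy A(3) by (intro divide_nonneg_nonneg Mahavier_nonneg) auto
    show "connected_component (A \<inter> B) x y"
    proof (cases "r \<le> 1")
      case True
      then show ?thesis using * xy y \<open>r \<ge> 0\<close> by blast
    next
      case False
      then have "x = dilate (1 / r) y" using y by simp
      then show ?thesis
        using *[of y x "1 / r"] xy False by (auto simp: connected_component_sym_eq)
    qed
  qed
qed

lemma hereditarily_unicoherent_Mahavier: "hereditarily_unicoherent Mahavier"
  unfolding hereditarily_unicoherent_def
proof (intro allI impI, elim conjE)
  fix Y assume Y: "Y \<subseteq> Mahavier" "continuum Y"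
  show "unicoherent Y"
  proof (rule unicoherentI)
    fix S T
    assume ST: "connected S" "connected T" "Y = S \<union> T"
      "closedin (top_of_set Y) S" "closedin (top_of_set Y) T"
    then have "closed S" "closed T"
      using Y(2) by (auto simp: continuum_def intro: closedin_closed_trans compact_imp_closed)
    then show "connected (S \<inter> T)"
      using ST Y by (intro connected_Int_Mahavier) auto
  qed
qed

section \<open>Arcs\<close>

lemma dilate_cancel:
  assumes "x \<noteq> origin" "dilate s x = dilate t x"
  shows "s = t"
proof -
  obtain n where "x n \<noteq> 0" using assms(1) by (auto simp: origin_def)
  with assms(2) show ?thesis by (auto simp: dilate_def dest: fun_cong[of _ _ n])
qed

lemma arc_dilates:
  assumes "x \<noteq> origin" "a \<noteq> b"
  shows "arc_joining (dilate a x) (dilate b x) ((\<lambda>t. dilate ((1 - t) * a + t * b) x) ` {0..1})"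
  unfolding arc_joining_def
proof (intro exI conjI)
  let ?g = "\<lambda>t. dilate ((1 - t) * a + t * b) x"
  show "arc ?g"
    unfolding arc_def path_def
  proof
    show "continuous_on {0..1} ?g" by (intro continuous_intros continuous_on_id)
    show "inj_on ?g {0..1}"
    proof (rule inj_onI)
      fix s t assume "?g s = ?g t"
      then have "(1 - s) * a + s * b = (1 - t) * a + t * b"
        using dilate_cancel assms(1) by blast
      then have "(s - t) * (b - a) = 0" by (simp add: algebra_simps)
      with assms(2) show "s = t" by simp
    qed
  qed
qed (auto simp: path_image_def pathstart_def pathfinish_def)

lemma arc_spoke: "x \<noteq> origin \<Longrightarrow> arc_joining origin x (spoke x)"
  using arc_dilates[of x 0 1] by (simp add: spoke_def)

lemma arc_joining_sym: "arc_joining x y A \<Longrightarrow> arc_joining y x A"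
  unfolding arc_joining_def by (metis arc_reversepath path_image_reversepath pathstart_reversepath pathfinish_reversepath)

lemma arc_joining_trans:
  assumes "arc_joining x y A" "arc_joining y z B" "A \<inter> B \<subseteq> {y}"
  shows "arc_joining x z (A \<union> B)"
proof -
  obtain g h where gh: "arc g" "path_image g = A" "pathstart g = x" "pathfinish g = y"
    "arc h" "path_image h = B" "pathstart h = y" "pathfinish h = z"
    using assms unfolding arc_joining_def by blast
  then have "arc (g +++ h)" using assms(3) by (intro arc_join) auto
  with gh show ?thesis
    unfolding arc_joining_def by (intro exI[of _ "g +++ h"]) (auto simp: path_image_join)
qed

text \<open>Points on a common ray are joined by a segment of it. Spokes on different rays meet only
  at the origin, so their union is an arc.\<close>

lemma arcwise_connected_Mahavier: "arcwise_connected Mahavier"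
  unfolding arcwise_connected_def
proof (intro ballI impI)
  fix x y assume xy: "x \<in> Mahavier" "y \<in> Mahavier" "x \<noteq> y"
  consider "x = origin" | "y = origin" | r where "x \<noteq> origin" "y = dilate r x"
    | "x \<noteq> origin" "y \<noteq> origin" "\<nexists>r. y = dilate r x" by metis
  then show "\<exists>A\<subseteq>Mahavier. arc_joining x y A"
  proof cases
    case 1
    then show ?thesis using xy arc_spoke[of y] spoke_subset_Mahavier[of y] by auto
  next
    case 2
    then show ?thesis
      using xy arc_joining_sym[OF arc_spoke[of x]] spoke_subset_Mahavier[of x] by auto
  next
    case 3
    let ?A = "(\<lambda>t. dilate ((1 - t) * 1 + t * r) x) ` {0..1}"
    have "dilate ((1 - t) * 1 + t * r) x \<in> Mahavier" if t: "t \<in> {0..1}" for t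
    proof (rule dilate_in_Mahavier[OF xy(1)])
      fix i
      \<comment> \<open>The factor \<open>r\<close> may exceed 1, so the bound by 1 comes from
        convexity: each coordinate lies between those of \<open>x\<close> and
        \<open>y\<close>.\<close>
      have *: "((1 - t) * 1 + t * r) * co x i = (1 - t) * co x i + t * co y i" for i
        by (simp add: 3 algebra_simps)
      show "((1 - t) * 1 + t * r) * co x i \<le> 1"
        unfolding * using t Mahavier_le_1 xy by (intro convex_bound_le) auto
      have "((1 - t) * 1 + t * r) * co x i \<ge> 0"
        unfolding * using t Mahavier_nonneg xy by simp
      then show "(1 - t) * 1 + t * r \<ge> 0"
        using co_pos[OF xy(1) 3(1), of i] by (simp add: zero_le_mult_iff)
    qed
    then have "?A \<subseteq> Mahavier" by blast
    moreover have "1 \<noteq> r" using 3 xy(3) by (metis dilate_1)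
    then have "arc_joining x y ?A"
      using arc_dilates[of x 1 r] 3 by simp
    ultimately show ?thesis by blast
  next
    case 4
    have "spoke x \<inter> spoke y \<subseteq> {origin}"
    proof
      fix z assume "z \<in> spoke x \<inter> spoke y"
      then have "z \<in> spoke x" "z \<in> spoke y" by auto
      then obtain s t where z: "z = dilate s x" "z = dilate t y"
        unfolding spoke_def by (elim imageE) metis
      show "z \<in> {origin}"
      proof (cases "t = 0")
        case False
        have "dilate (1 / t * s) x = dilate (1 / t) z" unfolding z(1) by simp
        also have "\<dots> = y" unfolding z(2) using False by simp
        finally show ?thesis using 4(3) by blast
      qed (use z in auto)
    qed
    then have "arc_joining x y (spoke x \<union> spoke y)"
      using arc_joining_trans[OF arc_joining_sym[OF arc_spoke[OF 4(1)]] arc_spoke[OF 4(2)]] by simp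
    moreover have "spoke x \<union> spoke y \<subseteq> Mahavier"
      using spoke_subset_Mahavier[OF xy(1)] spoke_subset_Mahavier[OF xy(2)] by (rule Un_least)
    ultimately show ?thesis by blast
  qed
qed

lemma dendroid_Mahavier: "dendroid Mahavier"
  by (simp add: dendroid_def continuum_Mahavier arcwise_connected_Mahavier
      hereditarily_unicoherent_Mahavier)

section \<open>The origin as the only ramification point\<close>

text \<open>Intermediate values: if both functions move from \<open>c\<close> to the same side, the
  end value closer to \<open>c\<close> is also attained by the other function, at a parameter other
  than 0.\<close>

lemma arms_share_value:
  fixes f g :: "real \<Rightarrow> real"
  assumes f: "continuous_on {0..d} f" and g: "continuous_on {0..d} g" and "d > 0"
    and "f 0 = c" "g 0 = c" and same: "(f d - c) * (g d - c) > 0"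
  shows "\<exists>s t. 0 < s \<and> s \<le> d \<and> 0 < t \<and> t \<le> d \<and> f s = g t"
proof -
  have *: "\<exists>s t. 0 < s \<and> s \<le> d \<and> 0 < t \<and> t \<le> d \<and> f s = g t"
    if hyps: "continuous_on {0..d} f" "continuous_on {0..d} g" "f 0 = c" "g 0 = c" "c < f d" "f d \<le> g d"
    for f g :: "real \<Rightarrow> real" and c
  proof -
    obtain t where "0 \<le> t" "t \<le> d" "g t = f d"
      using IVT'[of g 0 "f d" d] hyps \<open>d > 0\<close> by auto
    moreover have "t \<noteq> 0" using hyps \<open>g t = f d\<close> by auto
    ultimately show ?thesis using \<open>d > 0\<close> by (intro exI[of _ d] exI[of _ t]) auto
  qed
  \<comment> \<open>The four cases come from the first by exchanging \<open>f\<close> and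
    \<open>g\<close> and by changing signs.\<close>
  consider "c < f d" "f d \<le> g d" | "c < g d" "g d \<le> f d"
    | "- c < - f d" "- f d \<le> - g d" | "- c < - g d" "- g d \<le> - f d"
    using same linorder_linear[of "f d" "g d"] by (auto simp: zero_less_mult_iff)
  then show ?thesis
  proof cases
    case 1
    then show ?thesis using *[of f g c] assms by auto
  next
    case 2
    then show ?thesis using *[of g f c] assms by metis
  next
    case 3
    then show ?thesis
      using *[of "\<lambda>t. - f t" "\<lambda>t. - g t" "- c"] assms by (auto intro: continuous_on_minus)
  next
    case 4
    then have "\<exists>s t. 0 < s \<and> s \<le> d \<and> 0 < t \<and> t \<le> d \<and> - g s = - f t"
      using assms by (intro *[of "\<lambda>t. - g t" "\<lambda>t. - f t" "- c"] continuous_on_minus) auto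
    then show ?thesis by (metis neg_equal_iff_equal)
  qed
qed

text \<open>Around a top other than the origin a small subtriod has an image that avoids the origin,
  so coordinate 0 is injective there. That would give a continuous injection of a triod into the
  line.\<close>

lemma ramification_point_Mahavier_eq_origin:
  assumes "v \<in> ramification_points Mahavier"
  shows "v = origin"
proof (rule ccontr)
  assume "v \<noteq> origin"
  obtain T h k where T: "T \<subseteq> Mahavier" and hom: "homeomorphism standard_triod T h k" and v: "h (0, 0) = v"
    using assms by (auto simp: ramification_points_def)
  have cont: "continuous_on standard_triod h" and img: "h ` standard_triod = T"
    using hom by (auto simp: homeomorphism_def)
  have inj: "inj_on h standard_triod"
    using hom by (metis homeomorphism_def inj_on_inverseI)
  define f where "f z = co (h z) 0" for z
  have fc: "continuous_on standard_triod f"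
    unfolding f_def by (intro continuous_intros cont)
  have o: "(0, 0) \<in> standard_triod" by (simp add: standard_triod_def)
  have "v \<in> Mahavier" using T img o v by blast
  then have f0: "f (0, 0) > 0" using co_pos v \<open>v \<noteq> origin\<close> by (simp add: f_def)
  then obtain e where e: "e > 0"
    "\<And>z. z \<in> standard_triod \<Longrightarrow> dist z (0, 0) < e \<Longrightarrow> dist (f z) (f (0, 0)) < f (0, 0)"
    using fc o unfolding continuous_on_iff by meson
  \<comment> \<open>Arms of length \<open>d\<close> stay within \<open>e\<close> of the centre,
    where coordinate 0 remains positive.\<close>
  define d where "d = min 1 (e / 2)"
  have d: "0 < d" "d \<le> 1" "d < e" using e by (auto simp: d_def)
  define S where "S = (\<lambda>t. (- t, 0)) ` {0..d} \<union> (\<lambda>t. (t, 0)) ` {0..d} \<union> (\<lambda>t. (0, t)) ` {0..d}"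
  have S: "S \<subseteq> standard_triod"
    using d by (auto simp: S_def standard_triod_def)
  have arms: "(0, 0) \<in> (\<lambda>t. (- t, 0 :: real)) ` {0..d}" "(0, 0) \<in> (\<lambda>t. (t, 0 :: real)) ` {0..d}"
    "(0, 0) \<in> (\<lambda>t. (0 :: real, t)) ` {0..d}"
    using d by (auto intro: image_eqI[of _ _ 0])
  have "connected ((\<lambda>t. (- t, 0 :: real)) ` {0..d})" "connected ((\<lambda>t. (t, 0 :: real)) ` {0..d})"
    "connected ((\<lambda>t. (0 :: real, t)) ` {0..d})"
    by (intro connected_continuous_image continuous_intros connected_Icc)+
  with arms have "connected S"
    unfolding S_def by (intro connected_Un) blast+
  have fpos: "f z > 0" if "z \<in> S" for z
  proof -
    have "dist z (0, 0) < e" using that d by (auto simp: S_def dist_Pair_Pair dist_real_def)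
    then have "dist (f z) (f (0, 0)) < f (0, 0)" using that S by (intro e) auto
    then show ?thesis by (auto simp: dist_real_def)
  qed
  have "origin \<notin> h ` S"
  proof
    assume "origin \<in> h ` S"
    then obtain z where "z \<in> S" "h z = origin" by (metis imageE)
    with fpos[of z] show False by (simp add: f_def)
  qed
  moreover have "connected (h ` S)"
    using connected_continuous_image[OF continuous_on_subset[OF cont S] \<open>connected S\<close>] .
  moreover have "h ` S \<subseteq> Mahavier"
    using image_mono[OF S, of h] T img by simp
  ultimately have "inj_on (\<lambda>x. co x 0) (h ` S)"
    by (intro Mahavier_coordinate_inj)
  then have fi: "inj_on f S"
    using comp_inj_on[OF inj_on_subset[OF inj S]] unfolding f_def comp_def by blast
  have sub: "(- t, 0) \<in> S" "(t, 0) \<in> S" "(0, t) \<in> S" if "0 \<le> t" "t \<le> d" for t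
    using that by (auto simp: S_def)
  have comp: "continuous_on {0..d} (\<lambda>t. f (g t))" if "continuous_on {0..d} g" "g ` {0..d} \<subseteq> S" for g
    using continuous_on_compose2[OF fc that(1)] that(2) S by blast
  have c: "continuous_on {0..d} (\<lambda>t. f (- t, 0))" "continuous_on {0..d} (\<lambda>t. f (t, 0))"
    "continuous_on {0..d} (\<lambda>t. f (0, t))"
    by (rule comp; auto simp: sub intro!: continuous_intros)+
  have feq: "f p = f q \<longleftrightarrow> p = q" if "p \<in> S" "q \<in> S" for p q
    using inj_on_eq_iff[OF fi that] .
  have ne: "f (- d, 0) \<noteq> f (0, 0)" "f (d, 0) \<noteq> f (0, 0)" "f (0, d) \<noteq> f (0, 0)"
    using d sub(2)[of 0] by (simp_all add: feq sub)
  have no: "\<not> (\<exists>s t. 0 < s \<and> s \<le> d \<and> 0 < t \<and> t \<le> d \<and> f (- s, 0) = f (t, 0))"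
    "\<not> (\<exists>s t. 0 < s \<and> s \<le> d \<and> 0 < t \<and> t \<le> d \<and> f (- s, 0) = f (0, t))"
    "\<not> (\<exists>s t. 0 < s \<and> s \<le> d \<and> 0 < t \<and> t \<le> d \<and> f (s, 0) = f (0, t))"
    by (auto simp: feq sub less_imp_le)
  \<comment> \<open>Of three nonzero differences two have the same sign, so two arms leave the
    centre on the same side.\<close>
  consider "(f (- d, 0) - f (0, 0)) * (f (d, 0) - f (0, 0)) > 0"
    | "(f (- d, 0) - f (0, 0)) * (f (0, d) - f (0, 0)) > 0"
    | "(f (d, 0) - f (0, 0)) * (f (0, d) - f (0, 0)) > 0"
    using ne unfolding zero_less_mult_iff by linarith
  then show False
  proof cases
    case 1
    then show ?thesis using arms_share_value[OF c(1,2) d(1)] no by auto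
  next
    case 2
    then show ?thesis using arms_share_value[OF c(1,3) d(1)] no by auto
  next
    case 3
    then show ?thesis using arms_share_value[OF c(2,3) d(1)] no by auto
  qed
qed

text \<open>An explicit nonzero point with maximum at \<open>k\<close>. Peaks at different indices
  are not proportional, so their spokes serve as the arms of a triod.\<close>

definition peak :: "int \<Rightarrow> nat \<Rightarrow> real" where
  "peak k = of_co (\<lambda>i. if k \<le> i then (1/2) ^ nat (i - k) else (1/3) ^ nat (k - i))"

lemma peak_in_Mahavier: "peak k \<in> Mahavier"
proof (rule MahavierI)
  fix i
  consider "k \<le> i" "nat (i + 1 - k) = Suc (nat (i - k))" | "i < k" "nat (k - i) = Suc (nat (k - (i + 1)))"
    by linarith
  then show "co (peak k) (i + 1) = co (peak k) i / 2 \<or> co (peak k) (i + 1) = 3 * co (peak k) i"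
    by cases (auto simp: peak_def)
qed (auto simp: peak_def power_le_one)

lemma origin_ramification_point: "origin \<in> ramification_points Mahavier"
proof -
  \<comment> \<open>The two \<open>max\<close> terms are the positive and negative parts of the
    first coordinate, so each arm is mapped linearly onto the spoke of one of three peaks.\<close>
  let ?h = "\<lambda>z :: real \<times> real. of_co (\<lambda>i. max (fst z) 0 * co (peak 0) i
    + max (- fst z) 0 * co (peak (-1)) i + snd z * co (peak (-2)) i)"
  have compact: "compact standard_triod"
    unfolding standard_triod_def by (intro compact_Un compact_Times compact_Icc) auto
  have cont: "continuous_on standard_triod ?h"
    by (rule continuous_on_into_co) (simp, intro continuous_intros)
  have inj: "inj_on ?h standard_triod"
  proof (rule inj_onI)
    fix p q :: "real \<times> real" assume eq: "?h p = ?h q"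
    have "max (fst p) 0 * co (peak 0) i + max (- fst p) 0 * co (peak (-1)) i + snd p * co (peak (-2)) i
      = max (fst q) 0 * co (peak 0) i + max (- fst q) 0 * co (peak (-1)) i + snd q * co (peak (-2)) i" for i
      using arg_cong[OF eq, of "\<lambda>x. co x i"] by simp
    \<comment> \<open>The values of the three peaks at these indices form a nonsingular matrix, so
      the coefficients are determined.\<close>
    from this[of 0] this[of "-1"] this[of "-2"]
    have "max (fst p) 0 = max (fst q) 0 \<and> max (- fst p) 0 = max (- fst q) 0 \<and> snd p = snd q"
      by (simp add: peak_def eval_nat_numeral)
    then show "p = q" by (intro prod_eqI) auto
  qed
  have img: "?h ` standard_triod \<subseteq> Mahavier"
  proof clarify
    fix u w assume "(u, w) \<in> standard_triod"
    then consider "0 \<le> u" "u \<le> 1" "w = 0" | "-1 \<le> u" "u \<le> 0" "w = 0" | "u = 0" "0 \<le> w" "w \<le> 1"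
      by (fastforce simp: standard_triod_def)
    then have "\<exists>t k. 0 \<le> t \<and> t \<le> 1 \<and> ?h (u, w) = dilate t (peak k)"
    proof cases
      case 1
      then show ?thesis by (intro exI[of _ u] exI[of _ 0]) (auto intro!: co_eqI)
    next
      case 2
      then show ?thesis by (intro exI[of _ "- u"] exI[of _ "-1"]) (auto intro!: co_eqI)
    next
      case 3
      then show ?thesis by (intro exI[of _ w] exI[of _ "-2"]) (auto intro!: co_eqI)
    qed
    then show "?h (u, w) \<in> Mahavier"
      using dilate_in_Mahavier' peak_in_Mahavier by metis
  qed
  obtain k where "homeomorphism standard_triod (?h ` standard_triod) ?h k"
    using homeomorphism_compact[OF compact cont refl inj] by blast
  moreover have "?h (0, 0) = origin" by (auto intro: co_eqI)
  ultimately show ?thesis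
    using img unfolding ramification_points_def by blast
qed

lemma fan_with_top_Mahavier: "fan_with_top Mahavier origin"
  using dendroid_Mahavier origin_ramification_point ramification_point_Mahavier_eq_origin
  by (auto simp: fan_with_top_def fan_def)

section \<open>Uniqueness of arcs from the origin and smoothness\<close>

text \<open>Pulled back to the parameter interval, \<open>L\<close> becomes a connected set
  containing 0 and 1, hence everything.\<close>

lemma arc_minimal:
  fixes g :: "real \<Rightarrow> 'a::t2_space"
  assumes "arc g" and L: "connected L" "L \<subseteq> path_image g" "pathstart g \<in> L" "pathfinish g \<in> L"
  shows "path_image g = L"
proof -
  obtain h where h: "homeomorphism {0..1} (path_image g) g h"
    using homeomorphism_arc[OF assms(1)] by blast
  have "connected (h ` L)"
    using h L by (intro connected_continuous_image) (auto simp: homeomorphism_def intro: continuous_on_subset)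
  moreover have "h (g 0) = 0" "h (g 1) = 1"
    using h by (auto simp: homeomorphism_def)
  then have "0 \<in> h ` L" "1 \<in> h ` L"
    using L(3,4) unfolding pathstart_def pathfinish_def by (metis image_eqI)+
  ultimately have "{0..1} \<subseteq> h ` L"
    by (intro connected_contains_Icc)
  then have "g ` {0..1} \<subseteq> g ` h ` L" by blast
  also have "g ` h ` L = L"
  proof -
    have "g (h z) = z" if "z \<in> L" for z
      using h L(2) that unfolding homeomorphism_def by blast
    then show ?thesis by (simp add: image_image)
  qed
  finally show ?thesis using L(2) by (auto simp: path_image_def)
qed

text \<open>Any arc from the origin to \<open>x\<close> is closed and connected, so it contains
  \<open>spoke x\<close>; \<open>arc_minimal\<close> turns the inclusion into equality and thereby
  settles the definite description.\<close>

lemma arc_in_Mahavier_origin: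
  assumes "x \<in> Mahavier"
  shows "arc_in Mahavier origin x = spoke x"
proof (cases "x = origin")
  case True
  then show ?thesis by (auto simp: arc_in_def spoke_def image_constant_conv)
next
  case False
  have "(THE A. A \<subseteq> Mahavier \<and> arc_joining origin x A) = spoke x"
  proof (rule the_equality)
    fix A assume A: "A \<subseteq> Mahavier \<and> arc_joining origin x A"
    then obtain g where g: "arc g" "path_image g = A" "pathstart g = origin" "pathfinish g = x"
      unfolding arc_joining_def by blast
    have "closed A" "connected A" "x \<in> A" "origin \<in> A"
      using closed_arc_image[OF g(1)] connected_arc_image[OF g(1)] pathstart_in_path_image[of g]
        pathfinish_in_path_image[of g] g by auto
    then have "spoke x \<subseteq> A" using A by (intro spoke_subset_connected) auto
    then show "A = spoke x"
      using arc_minimal[OF g(1), of "spoke x"] g connected_dilates[of x 0 1]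
        origin_in_spoke self_in_spoke by (simp add: spoke_def)
  qed (use False assms arc_spoke spoke_subset_Mahavier in auto)
  with False show ?thesis by (simp add: arc_in_def)
qed

text \<open>Points with the same parameter on the two spokes are paired and compared by
  \<open>dist_dilate_le\<close>. The same estimate bounds the suprema, as their nonnegativity
  requires.\<close>

lemma hausdorff_distance_spoke_le:
  "0 \<le> hausdorff_distance (spoke x) (spoke y)" "hausdorff_distance (spoke x) (spoke y) \<le> dist x y"
proof -
  have *: "infdist a (spoke y) \<le> dist x y" if a: "a \<in> spoke x" for a x y
  proof -
    obtain t where t: "t \<in> {0..1}" "a = dilate t x" using a by (auto simp: spoke_def)
    then have "dilate t y \<in> spoke y" by (auto simp: spoke_def)
    then have "infdist a (spoke y) \<le> dist a (dilate t y)" by (rule infdist_le)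
    also have "\<dots> \<le> dist x y" using t dist_dilate_le[of t x y] by simp
    finally show ?thesis .
  qed
  have ne: "spoke z \<noteq> {}" for z using self_in_spoke by blast
  have "(SUP a\<in>spoke x. infdist a (spoke y)) \<le> dist x y"
    by (rule cSUP_least[OF ne]) (rule *)
  moreover have "(SUP b\<in>spoke y. infdist b (spoke x)) \<le> dist y x"
    by (rule cSUP_least[OF ne]) (rule *)
  ultimately show "hausdorff_distance (spoke x) (spoke y) \<le> dist x y"
    by (simp add: hausdorff_distance_def dist_commute)
  have "0 \<le> infdist x (spoke y)" by (rule infdist_nonneg)
  also have "\<dots> \<le> (SUP a\<in>spoke x. infdist a (spoke y))"
    by (rule cSUP_upper[OF self_in_spoke]) (rule bdd_aboveI2, rule *)
  finally show "0 \<le> hausdorff_distance (spoke x) (spoke y)"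
    by (simp add: hausdorff_distance_def)
qed

lemma smooth_fan_Mahavier: "smooth_fan Mahavier origin"
  unfolding smooth_fan_def
proof (intro conjI fan_with_top_Mahavier ballI allI impI, elim conjE)
  fix x :: "nat \<Rightarrow> real" and s :: "nat \<Rightarrow> nat \<Rightarrow> real"
  assume x: "x \<in> Mahavier" and s: "\<forall>n. s n \<in> Mahavier" "s \<longlonglongrightarrow> x"
  have "(\<lambda>n. dist (s n) x) \<longlonglongrightarrow> 0" using s(2) tendsto_dist_iff by blast
  then have "(\<lambda>n. hausdorff_distance (spoke (s n)) (spoke x)) \<longlonglongrightarrow> 0"
    by (rule tendsto_sandwich[OF _ _ tendsto_const, rotated -1])
      (auto simp: hausdorff_distance_spoke_le)
  then show "(\<lambda>n. hausdorff_distance (arc_in Mahavier origin (s n)) (arc_in Mahavier origin x)) \<longlonglongrightarrow> 0"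
    using x s(1) by (simp add: arc_in_Mahavier_origin)
qed

section \<open>A criterion for end-points\<close>

text \<open>Coordinate \<open>j\<close> is maximal at \<open>x\<close>. If \<open>x\<close> were
  interior to an arc, this coordinate would be positive on a short subarc around \<open>x\<close>,
  hence injective and continuous there, hence strictly monotone, which excludes an interior
  maximum.\<close>

lemma end_points_MahavierI:
  assumes x: "x \<in> Mahavier" and j: "co x j = 1"
  shows "x \<in> end_points Mahavier"
  unfolding end_points_def
proof (intro CollectI conjI x allI impI, elim conjE)
  fix A a b assume A: "A \<subseteq> Mahavier" "arc_joining a b A" "x \<in> A"
  then obtain g where g: "arc g" "path_image g = A" "g 0 = a" "g 1 = b"
    unfolding arc_joining_def pathstart_def pathfinish_def by blast
  then have gc: "continuous_on {0..1} g" and gi: "inj_on g {0..1}"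
    by (auto simp: arc_def path_def)
  obtain s where s: "s \<in> {0..1}" "g s = x"
    using A(3) g(2) by (auto simp: path_image_def)
  have gM: "g t \<in> Mahavier" if "t \<in> {0..1}" for t
    using that A(1) g(2) by (auto simp: path_image_def)
  define f where "f t = co (g t) j" for t
  have fc: "continuous_on {0..1} f"
    unfolding f_def by (intro continuous_intros gc)
  show "x = a \<or> x = b"
  proof (rule ccontr)
    assume "\<not> ?thesis"
    then have s01: "0 < s" "s < 1"
      using s g by (auto simp: less_le)
    obtain e where e: "e > 0" "\<And>t. t \<in> {0..1} \<Longrightarrow> dist t s < e \<Longrightarrow> dist (f t) (f s) < 1"
      using fc s(1) unfolding continuous_on_iff by (meson zero_less_one)
    define d where "d = min (e / 2) (min s (1 - s))"
    have d: "0 < d" "d < e" "0 \<le> s - d" "s + d \<le> 1"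
      using e(1) s01 by (auto simp: d_def)
    let ?I = "{s - d..s + d}"
    have I: "?I \<subseteq> {0..1}" using d by auto
    have fs: "f s = 1" by (simp add: f_def s j)
    have fpos: "f t > 0" if "t \<in> ?I" for t
    proof -
      have "dist t s < e" using that d by (auto simp: dist_real_def)
      then have "dist (f t) (f s) < 1" using that I by (intro e) auto
      then show ?thesis by (auto simp: dist_real_def fs)
    qed
    have "connected (g ` ?I)"
      by (intro connected_continuous_image continuous_on_subset[OF gc I] connected_Icc)
    moreover have "g ` ?I \<subseteq> Mahavier" using gM I by blast
    moreover have "origin \<notin> g ` ?I"
    proof
      assume "origin \<in> g ` ?I"
      then obtain t where "t \<in> ?I" "g t = origin" by (metis imageE)
      with fpos[of t] show False by (simp add: f_def)
    qed
    ultimately have "inj_on (\<lambda>x. co x j) (g ` ?I)" by (rule Mahavier_coordinate_inj)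
    then have "inj_on f ?I"
      using comp_inj_on[OF inj_on_subset[OF gi I]] unfolding f_def comp_def by blast
    then have "f (s - d) < f s \<and> f s < f (s + d) \<or> f (s - d) > f s \<and> f s > f (s + d)"
      using d continuous_inj_imp_mono[of "s - d" s "s + d" f] continuous_on_subset[OF fc I] by auto
    moreover have "f (s - d) \<le> 1" "f (s + d) \<le> 1"
      unfolding f_def using d s01 by (intro Mahavier_le_1 gM; simp)+
    ultimately show False using fs by auto
  qed
qed

section \<open>Multiplicative independence of 2 and 3\<close>

lemma log_2_3_irrational: "log 2 3 \<notin> \<rat>"
proof
  assume "log 2 3 \<in> \<rat>"
  then obtain m n :: nat where "n \<noteq> 0" "\<bar>log 2 3\<bar> = real m / real n"
    by (rule Rats_abs_nat_div_natE)
  then have mn: "n \<noteq> 0" "real n * log 2 3 = real m" by (auto simp: field_simps)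
  have "2 powr (real n * log 2 3) = 3 ^ n"
    by (simp add: powr_powr[symmetric] mult.commute[of "real n"] powr_realpow)
  then have "(3 ^ n :: real) = 2 ^ m" using mn by (simp add: powr_realpow)
  then have eq: "(3 ^ n :: nat) = 2 ^ m"
    by (metis of_nat_eq_iff of_nat_numeral of_nat_power)
  have "odd (3 ^ n :: nat)" by simp
  then have "m = 0" unfolding eq by (metis dvd_power gr0I)
  with eq mn show False by simp
qed

text \<open>In logarithms to base 2 the question becomes the density of the numbers
  \<open>l * log 2 3 - h\<close>, which follows from the irrationality of
  \<open>log 2 3\<close>.\<close>

lemma halving_tripling_dense:
  fixes r p q :: real
  assumes "0 < r" "0 < p" "p < q"
  obtains k l where "p < r * (1/2) ^ k * 3 ^ l" "r * (1/2) ^ k * 3 ^ l < q"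
proof -
  \<comment> \<open>The density theorem gives an integer \<open>h\<close> of unknown sign. Starting
    above \<open>q\<close>, with \<open>m\<close> extra triplings, forces \<open>h > 0\<close>,
    because triplings alone cannot lead down below \<open>q\<close>.\<close>
  obtain m where m: "q / r < 3 ^ m" using real_arch_pow[of 3 "q / r"] by auto
  define r' where "r' = r * 3 ^ m"
  have r': "r' > q" using m assms by (simp add: r'_def field_simps)
  \<comment> \<open>The target is the midpoint of \<open>log 2 p\<close> and \<open>log 2 q\<close>,
    approximated to within half their distance.\<close>
  define \<alpha> where "\<alpha> = (log 2 p + log 2 q) / 2 - log 2 r'"
  have "(log 2 q - log 2 p) / 2 > 0" using assms by simp
  then obtain h l where l: "l > 0" "\<bar>of_int l * log 2 3 - of_int h - \<alpha>\<bar> < (log 2 q - log 2 p) / 2"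
    by (rule sequence_of_fractional_parts_is_dense[OF log_2_3_irrational])
  then have b: "log 2 p < log 2 r' + of_int l * log 2 3 - of_int h"
    "log 2 r' + of_int l * log 2 3 - of_int h < log 2 q"
    unfolding \<alpha>_def abs_less_iff by (auto simp: field_simps)
  have "log 2 q < log 2 r'" using r' assms by simp
  moreover have "of_int l * log 2 3 > 0" using l by simp
  ultimately have "real_of_int h > 0" using b by linarith
  then have h: "h > 0" by simp
  let ?z = "r * (1/2) ^ nat h * 3 ^ (m + nat l)"
  have "?z = r' * 3 ^ nat l / 2 ^ nat h"
    by (simp add: r'_def power_add power_one_over field_simps)
  then have "log 2 ?z = log 2 r' + of_int l * log 2 3 - of_int h"
    using assms r' l h by (simp add: log_mult log_divide log_nat_power)
  with b have "log 2 p < log 2 ?z" "log 2 ?z < log 2 q" by auto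
  moreover have "?z > 0" using assms by simp
  ultimately have "p < ?z" "?z < q" using assms by (auto simp only: log_less_cancel_iff)
  then show ?thesis by (rule that)
qed

section \<open>Prescribing the future of a point\<close>

definition forward_path :: "(nat \<Rightarrow> real) \<Rightarrow> bool" where
  "forward_path w \<longleftrightarrow> (\<forall>j. 0 \<le> w j \<and> w j \<le> 1 \<and> (w (Suc j) = w j / 2 \<or> w (Suc j) = 3 * w j))"

lemma forward_path_prepend:
  assumes "forward_path w" "0 \<le> a" "a \<le> 1" "w 0 = a / 2 \<or> w 0 = 3 * a"
  shows "forward_path (case_nat a w)"
  using assms by (auto simp: forward_path_def split: nat.split)

text \<open>Predecessors are added one at a time; the intermediate heights are at most
  \<open>a\<close>, hence at most 1.\<close>

lemma forward_path_prepend_halvings: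
  assumes "forward_path w" "w 0 = a * (1/2) ^ k" "0 \<le> a" "a \<le> 1"
  obtains w' n where "forward_path w'" "w' 0 = a" "\<And>j. w' (n + j) = w j"
proof -
  have "\<exists>w' n. forward_path w' \<and> w' 0 = a \<and> (\<forall>j. w' (n + j) = w j)"
    using assms(1,2)
  proof (induction k arbitrary: w)
    case 0
    then show ?case by (intro exI[of _ w] exI[of _ 0]) auto
  next
    case (Suc k)
    let ?b = "a * (1/2) ^ k"
    have "?b \<le> 1" using assms(3,4) by (simp add: mult_le_one power_le_one)
    then have "forward_path (case_nat ?b w)"
      using Suc.prems assms(3) by (intro forward_path_prepend) auto
    from Suc.IH[OF this] obtain w' n where
      w': "forward_path w'" "w' 0 = a" "\<And>j. w' (n + j) = case_nat ?b w j" by auto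
    have "w' (Suc n + j) = w j" for j using w'(3)[of "Suc j"] by simp
    with w' show ?case by blast
  qed
  with that show ?thesis by blast
qed

text \<open>Here the intermediate heights are bounded by the final one, \<open>w 0\<close>, which is
  at most 1.\<close>

lemma forward_path_prepend_triplings:
  assumes "forward_path w" "w 0 = a * 3 ^ l" "0 \<le> a"
  obtains w' n where "forward_path w'" "w' 0 = a" "\<And>j. w' (n + j) = w j"
proof -
  have "\<exists>w' n. forward_path w' \<and> w' 0 = a \<and> (\<forall>j. w' (n + j) = w j)"
    using assms(1,2)
  proof (induction l arbitrary: w)
    case 0
    then show ?case by (intro exI[of _ w] exI[of _ 0]) auto
  next
    case (Suc l)
    let ?b = "a * 3 ^ l"
    have "0 \<le> ?b" using assms(3) by simp
    moreover have "w 0 \<le> 1" using Suc.prems(1) by (simp add: forward_path_def)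
    ultimately have "forward_path (case_nat ?b w)"
      using Suc.prems by (intro forward_path_prepend) auto
    from Suc.IH[OF this] obtain w' n where
      w': "forward_path w'" "w' 0 = a" "\<And>j. w' (n + j) = case_nat ?b w j" by auto
    have "w' (Suc n + j) = w j" for j using w'(3)[of "Suc j"] by simp
    with w' show ?case by blast
  qed
  with that show ?thesis by blast
qed

text \<open>Doing all halvings before the triplings keeps the path in [0, 1]: it first descends from
  \<open>a\<close> and then climbs to \<open>w 0\<close>.\<close>

lemma forward_path_connect:
  assumes "forward_path w" "w 0 = a * (1/2) ^ k * 3 ^ l" "0 \<le> a" "a \<le> 1"
  obtains w' n where "forward_path w'" "w' 0 = a" "\<And>j. w' (n + j) = w j"
proof -
  obtain w1 n1 where w1: "forward_path w1" "w1 0 = a * (1/2) ^ k" "\<And>j. w1 (n1 + j) = w j"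
    using forward_path_prepend_triplings[OF assms(1,2)] assms(3) by auto
  obtain w2 n2 where w2: "forward_path w2" "w2 0 = a" "\<And>j. w2 (n2 + j) = w1 j"
    using forward_path_prepend_halvings[OF w1(1,2) assms(3,4)] by auto
  have "w2 (n2 + n1 + j) = w j" for j
    using w2(3)[of "n1 + j"] w1(3)[of j] by (simp add: add.assoc)
  with w2 that show ?thesis by blast
qed

lemma glue_forward_path:
  assumes x: "x \<in> Mahavier" and w: "forward_path w" "w 0 = co x N"
  defines "y \<equiv> of_co (\<lambda>i. if i \<le> N then co x i else w (nat (i - N)))"
  shows "y \<in> Mahavier" "\<And>i. i \<le> N \<Longrightarrow> co y i = co x i" "\<And>j. co y (N + int j) = w j"
proof -
  show l: "co y i = co x i" if "i \<le> N" for i using that by (simp add: y_def)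
  \<comment> \<open>At the seam \<open>j = 0\<close> the left branch applies, and the two pieces
    agree there.\<close>
  show r: "co y (N + int j) = w j" for j using w(2) by (cases "j = 0") (auto simp: y_def)
  show "y \<in> Mahavier"
  proof (rule MahavierI)
    fix i
    consider "i < N" | j where "i = N + int j" by (metis not_less zle_iff_zadd)
    then have "0 \<le> co y i \<and> co y i \<le> 1 \<and> (co y (i + 1) = co y i / 2 \<or> co y (i + 1) = 3 * co y i)"
    proof cases
      case 1
      then show ?thesis
        using l[of i] l[of "i + 1"] Mahavier_nonneg[OF x, of i] Mahavier_le_1[OF x, of i]
          Mahavier_step[OF x, of i] by simp
    next
      case 2
      then show ?thesis
        using r[of j] r[of "Suc j"] w(1) by (simp add: forward_path_def ac_simps)
    qed
    then show "0 \<le> co y i" "co y i \<le> 1" "co y (i + 1) = co y i / 2 \<or> co y (i + 1) = 3 * co y i"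
      by auto
  qed
qed

section \<open>Density of the end-points\<close>

text \<open>The origin is not isolated: small multiples of a peak are uniformly close to it.\<close>

lemma nonzero_point_in_open:
  assumes U: "open U" "U \<inter> Mahavier \<noteq> {}"
  obtains x where "x \<in> U" "x \<in> Mahavier" "x \<noteq> origin"
proof (cases "origin \<in> U")
  case False
  with assms that show ?thesis by blast
next
  case True
  obtain N \<epsilon> where "\<epsilon> > 0" and nbd:
    "\<And>y. (\<And>i. \<bar>i\<bar> \<le> N \<Longrightarrow> \<bar>co y i - co origin i\<bar> < \<epsilon>) \<Longrightarrow> y \<in> U"
    using window_neighbourhood[OF U(1) True] by metis
  define t where "t = min 1 (\<epsilon> / 2)"
  have t: "0 < t" "t \<le> 1" "t < \<epsilon>" using \<open>\<epsilon> > 0\<close> by (auto simp: t_def)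
  let ?y = "dilate t (peak 0)"
  have "\<bar>co ?y i\<bar> < \<epsilon>" for i
  proof -
    have "\<bar>co ?y i\<bar> \<le> t"
      using t Mahavier_nonneg[OF peak_in_Mahavier, of 0 i] Mahavier_le_1[OF peak_in_Mahavier, of 0 i]
      by (simp add: abs_mult mult_left_le)
    with t show ?thesis by simp
  qed
  then have "?y \<in> U" by (intro nbd) simp
  moreover have "?y \<in> Mahavier" using t by (intro dilate_in_Mahavier' peak_in_Mahavier) auto
  moreover have "co ?y 0 \<noteq> 0" using t by (simp add: peak_def)
  then have "?y \<noteq> origin" by (metis co_origin)
  ultimately show ?thesis using that by blast
qed

text \<open>A point is perturbed by a factor close to \<open>1\<close> so that, after suitable halvings and triplings
  beyond the window, its orbit reaches height exactly \<open>1\<close>. The factor is chosen at most \<open>1\<close>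
  to keep the past inside the unit interval.\<close>

lemma end_point_in_open:
  assumes U: "open U" "U \<inter> Mahavier \<noteq> {}"
  shows "U \<inter> end_points Mahavier \<noteq> {}"
proof -
  obtain x where x: "x \<in> U" "x \<in> Mahavier" "x \<noteq> origin"
    using nonzero_point_in_open[OF assms] .
  obtain N \<epsilon> where "\<epsilon> > 0" and nbd:
    "\<And>y. (\<And>i. \<bar>i\<bar> \<le> N \<Longrightarrow> \<bar>co y i - co x i\<bar> < \<epsilon>) \<Longrightarrow> y \<in> U"
    using window_neighbourhood[OF U(1) x(1)] by metis
  \<comment> \<open>Continuing from the right end \<open>N\<close> of the window, \<open>x\<close>
    would reach a height slightly above 1; dividing by that height makes it exactly 1 and moves the
    window by less than \<open>\<epsilon>\<close>.\<close>
  obtain k l where kl: "1 < co x N * (1/2) ^ k * 3 ^ l" "co x N * (1/2) ^ k * 3 ^ l < 1 + \<epsilon>"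
    using halving_tripling_dense[of "co x N" 1 "1 + \<epsilon>"] co_pos[OF x(2,3)] \<open>\<epsilon> > 0\<close> by auto
  define c where "c = co x N * (1/2) ^ k * 3 ^ l"
  have c: "1 < c" "c < 1 + \<epsilon>" using kl by (auto simp: c_def)
  define x' where "x' = dilate (1 / c) x"
  have x': "x' \<in> Mahavier"
    unfolding x'_def using c x(2) by (intro dilate_in_Mahavier') auto
  have "forward_path (\<lambda>j. (1/2) ^ j)" by (simp add: forward_path_def power_le_one)
  moreover have "(1/2) ^ 0 = co x' N * (1/2) ^ k * 3 ^ l"
    using c by (simp add: x'_def) (simp add: c_def)
  ultimately obtain w n where w: "forward_path w" "w 0 = co x' N" "\<And>j. w (n + j) = (1/2) ^ j"
    by (rule forward_path_connect) (use Mahavier_nonneg[OF x'] Mahavier_le_1[OF x'] in auto)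
  define y where "y = of_co (\<lambda>i. if i \<le> N then co x' i else w (nat (i - N)))"
  have y: "y \<in> Mahavier" "\<And>i. i \<le> N \<Longrightarrow> co y i = co x' i" "\<And>j. co y (N + int j) = w j"
    unfolding y_def using glue_forward_path[OF x' w(1,2)] by auto
  have "co y (N + int n) = 1" using y(3)[of n] w(3)[of 0] by simp
  then have "y \<in> end_points Mahavier" by (rule end_points_MahavierI[OF y(1)])
  moreover have "\<bar>co y i - co x i\<bar> < \<epsilon>" if "\<bar>i\<bar> \<le> N" for i
  proof -
    have "co y i - co x i = - (co x i * (1 - 1 / c))"
      using y(2)[of i] that by (simp add: x'_def algebra_simps)
    moreover have "0 \<le> 1 - 1 / c" "1 - 1 / c < \<epsilon>"
    proof -
      show "0 \<le> 1 - 1 / c" using c by simp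
      have "1 - 1 / c = (c - 1) / c" using c by (simp add: diff_divide_distrib)
      also have "\<dots> \<le> c - 1" using c by (simp add: divide_le_eq mult_le_cancel_left1)
      finally show "1 - 1 / c < \<epsilon>" using c by simp
    qed
    moreover have "0 \<le> co x i * (1 - 1 / c)" "co x i * (1 - 1 / c) \<le> 1 - 1 / c"
      using calculation Mahavier_nonneg[OF x(2), of i] Mahavier_le_1[OF x(2), of i]
      by (auto intro: mult_left_le_one_le mult_nonneg_nonneg)
    ultimately show ?thesis by linarith
  qed
  then have "y \<in> U" by (rule nbd)
  ultimately show ?thesis by blast
qed

lemma Lelek_fan_Mahavier: "Lelek_fan Mahavier"
proof -
  have "closure (end_points Mahavier) \<subseteq> Mahavier"
    using compact_imp_closed[OF compact_Mahavier]
    by (intro closure_minimal) (auto simp: end_points_def)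
  moreover have "Mahavier \<subseteq> closure (end_points Mahavier)"
    unfolding closure_iff_nhds_not_empty subset_iff
    using end_point_in_open by blast
  ultimately show ?thesis
    using smooth_fan_Mahavier unfolding Lelek_fan_def by blast
qed

section \<open>The shift and its transitivity\<close>

definition shift :: "int \<Rightarrow> (nat \<Rightarrow> real) \<Rightarrow> nat \<Rightarrow> real" where
  "shift k x = of_co (\<lambda>i. co x (i + k))"

lemma co_shift [simp]: "co (shift k x) i = co x (i + k)"
  by (simp add: shift_def)

lemma shift_in_Mahavier:
  assumes "x \<in> Mahavier"
  shows "shift k x \<in> Mahavier"
proof (rule MahavierI)
  fix i
  show "co (shift k x) (i + 1) = co (shift k x) i / 2 \<or> co (shift k x) (i + 1) = 3 * co (shift k x) i"
    using Mahavier_step[OF assms, of "i + k"] by (simp add: add.commute add.left_commute)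
qed (use assms in \<open>auto intro: Mahavier_nonneg Mahavier_le_1\<close>)

lemma shift_shift [simp]: "shift j (shift k x) = shift (j + k) x"
  by (rule co_eqI) (simp add: ac_simps)

lemma shift_0 [simp]: "shift 0 x = x"
  by (rule co_eqI) simp

lemma funpow_shift: "(shift k ^^ n) x = shift (int n * k) x"
  by (induction n) (auto simp: algebra_simps)

lemma continuous_on_shift: "continuous_on S (shift k)"
  by (rule continuous_on_into_co) (simp, intro continuous_intros continuous_on_id)

lemma homeomorphism_shift: "homeomorphism Mahavier Mahavier (shift k) (shift (- k))"
  by (intro homeomorphismI continuous_on_shift) (auto simp: shift_in_Mahavier)

lemma transitive_shift: "transitive_system Mahavier (shift 1)"
  unfolding transitive_system_def
proof (intro conjI allI impI)
  show "dynamical_system Mahavier (shift 1)"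
    by (auto simp: dynamical_system_def intro: continuous_on_shift shift_in_Mahavier)
next
  fix U V
  assume "openin (top_of_set Mahavier) U \<and> openin (top_of_set Mahavier) V \<and> U \<noteq> {} \<and> V \<noteq> {}"
  then obtain U' V' where U': "open U'" "U = Mahavier \<inter> U'" "U' \<inter> Mahavier \<noteq> {}"
    and V': "open V'" "V = Mahavier \<inter> V'" "V' \<inter> Mahavier \<noteq> {}"
    unfolding openin_open by blast
  obtain u where u: "u \<in> U'" "u \<in> Mahavier" "u \<noteq> origin"
    using nonzero_point_in_open[OF U'(1,3)] .
  obtain v where v: "v \<in> V'" "v \<in> Mahavier" "v \<noteq> origin"
    using nonzero_point_in_open[OF V'(1,3)] .
  obtain N \<delta> where N: "N \<ge> 0" "\<delta> > 0" and nbdU: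
    "\<And>y. (\<And>i. \<bar>i\<bar> \<le> N \<Longrightarrow> \<bar>co y i - co u i\<bar> < \<delta>) \<Longrightarrow> y \<in> U'"
    using window_neighbourhood[OF U'(1) u(1)] by metis
  obtain K \<epsilon> where K: "K \<ge> 0" "\<epsilon> > 0" and nbdV:
    "\<And>y. (\<And>i. \<bar>i\<bar> \<le> K \<Longrightarrow> \<bar>co y i - co v i\<bar> < \<epsilon>) \<Longrightarrow> y \<in> V'"
    using window_neighbourhood[OF V'(1) v(1)] by metis
  \<comment> \<open>Multiplying \<open>r\<close> by halvings and triplings gives the factor
    \<open>c\<close> for which the path from \<open>co u N\<close> arrives at
    \<open>c * co v (- K)\<close>, the left end of the window of the contracted
    \<open>v\<close>.\<close>
  define r where "r = co u N / co v (- K)"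
  have "r > 0" using co_pos[OF u(2,3)] co_pos[OF v(2,3)] by (simp add: r_def)
  \<comment> \<open>The 1/2 keeps the lower bound positive when \<open>\<epsilon>\<close> is at
    least 1. A factor below 1 keeps the contracted \<open>v\<close> in the space, and one above
    \<open>1 - \<epsilon>\<close> keeps it close to \<open>v\<close>.\<close>
  moreover have "0 < max (1/2) (1 - \<epsilon>)" "max (1/2) (1 - \<epsilon>) < 1"
    using K by (auto simp: less_max_iff_disj)
  ultimately obtain k l where kl: "max (1/2) (1 - \<epsilon>) < r * (1/2) ^ k * 3 ^ l" "r * (1/2) ^ k * 3 ^ l < 1"
    by (rule halving_tripling_dense)
  define c where "c = r * (1/2) ^ k * 3 ^ l"
  have c: "0 < c" "1 - \<epsilon> < c" "c < 1" using kl by (auto simp: c_def)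
  have cv: "dilate c v \<in> Mahavier" using c v(2) by (intro dilate_in_Mahavier') auto
  have "forward_path (\<lambda>j. co (dilate c v) (int j - K))"
    unfolding forward_path_def
  proof (intro allI conjI Mahavier_nonneg Mahavier_le_1 cv)
    fix j
    have Suc: "int (Suc j) - K = int j - K + 1" by simp
    show "co (dilate c v) (int (Suc j) - K) = co (dilate c v) (int j - K) / 2 \<or>
        co (dilate c v) (int (Suc j) - K) = 3 * co (dilate c v) (int j - K)"
      using Mahavier_step[OF cv, of "int j - K"] unfolding Suc .
  qed
  moreover have "co (dilate c v) (int 0 - K) = co u N * (1/2) ^ k * 3 ^ l"
    using co_pos[OF v(2,3), of "- K"] by (simp add: c_def r_def)
  ultimately obtain w n where w: "forward_path w" "w 0 = co u N"
      "\<And>j. w (n + j) = co (dilate c v) (int j - K)"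
    by (rule forward_path_connect) (use Mahavier_nonneg[OF u(2)] Mahavier_le_1[OF u(2)] in auto)
  define y where "y = of_co (\<lambda>i. if i \<le> N then co u i else w (nat (i - N)))"
  have y: "y \<in> Mahavier" "\<And>i. i \<le> N \<Longrightarrow> co y i = co u i" "\<And>j. co y (N + int j) = w j"
    unfolding y_def using glue_forward_path[OF u(2) w(1,2)] by auto
  have "y \<in> U'" using N by (intro nbdU) (auto simp: y(2))
  then have "y \<in> U" using y(1) U'(2) by simp
  \<comment> \<open>The copy of the contracted \<open>v\<close> starts in \<open>y\<close> at index
    \<open>N + n\<close> with its coordinate \<open>- K\<close>; shifting by \<open>m\<close> moves
    that coordinate to index \<open>- K\<close>.\<close>
  define m where "m = nat N + n + nat K"
  have "\<bar>co (shift (int m) y) i - co v i\<bar> < \<epsilon>" if "\<bar>i\<bar> \<le> K" for i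
  proof -
    have iK: "0 \<le> i + K" using that by linarith
    then have im: "i + int m = N + int (n + nat (i + K))"
      using N K by (simp add: m_def)
    have "co (shift (int m) y) i = w (n + nat (i + K))"
      unfolding co_shift im by (rule y(3))
    also have "\<dots> = c * co v i"
      using iK by (simp add: w(3))
    finally have "co (shift (int m) y) i = c * co v i" .
    then have "co (shift (int m) y) i - co v i = - ((1 - c) * co v i)"
      by (simp add: algebra_simps)
    moreover have "0 \<le> (1 - c) * co v i" "(1 - c) * co v i \<le> 1 - c"
      using c Mahavier_nonneg[OF v(2), of i] Mahavier_le_1[OF v(2), of i]
      by (auto intro: mult_left_le mult_nonneg_nonneg)
    ultimately show ?thesis using c by linarith
  qed
  then have "shift (int m) y \<in> V'" by (rule nbdV)
  then have "(shift 1 ^^ m) y \<in> V"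
    using shift_in_Mahavier[OF y(1)] V'(2) by (simp add: funpow_shift)
  with \<open>y \<in> U\<close> show "\<exists>n. (shift 1 ^^ n) ` U \<inter> V \<noteq> {}" by blast
qed

theorem mainTheorem1:
  shows "\<exists>(X :: (nat \<Rightarrow> real) set) \<phi> \<psi>.
    Lelek_fan X \<and> homeomorphism X X \<phi> \<psi> \<and> transitive_system X \<phi>"
  using Lelek_fan_Mahavier homeomorphism_shift transitive_shift by blast

end
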